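(* Let $(X,A_1,\dots,A_n)$ satisfy condition $( * )$, let $p:X\to X/(A_1,\dots,A_n)$ be the quotient map, $a\in\bigcup_{i=1}^nA_i$ and $*=p(a)$. If $\pi_1^{top}(X,a)$ is compact and $\pi_1^{top}(X/(A_1,\dots,A_n),* )$ is Hausdorff, then $p_*:\pi_1^{top}(X,a)\to\pi_1^{top}(X/(A_1,\dots,A_n),* )$ is surjective, and it is a closed quotient map.
   Context: $X/(A_1,\dots,A_n)$ denotes the quotient space of $X$ by the equivalence relation generated by identifying all points of $A_i$ with each other for each $i$. $\pi_1^{top}(Y,y)$ is $\pi_1(Y,y)$ with the quotient topology with respect to the canonical surjection from the loop space $\Omega(Y,y)$ (based loops with the compact-open topology); $p_*$ is the induced continuous homomorphism. Condition $( * )$ on $(X,A_1,\dots,A_n)$ means one of: (i) $X$ is path connected and the $A_i$ are open subsets of $X$ whose closures are path connected; or (ii) $X$ is connected, locally path connected and first countable, and each $A_i$ is an open or closed subset of $X$, the closures $\overline{A_i}$ being path connected and pairwise disjoint. *)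

theory Defs
  imports "HOL-Analysis.Analysis"
begin

definition quotient_topology :: "'a topology \<Rightarrow> ('a \<Rightarrow> 'b) \<Rightarrow> 'b topology" where
  "quotient_topology X f =
     topology (\<lambda>U. U \<subseteq> f ` topspace X \<and> openin X {x \<in> topspace X. f x \<in> U})"

text \<open>Generating relation: identify all points of A_i with each other (i = 1..n);
  the equivalence relation is its transitive closure (the generating relation is
  already reflexive on the carrier and symmetric).\<close>
definition collapse_rel :: "'a topology \<Rightarrow> nat \<Rightarrow> (nat \<Rightarrow> 'a set) \<Rightarrow> ('a \<times> 'a) set" where
  "collapse_rel X n A =
     (Id_on (topspace X) \<union>
      {(x, y). \<exists>i\<in>{1..n}. x \<in> A i \<and> y \<in> A i \<and> x \<in> topspace X \<and> y \<in> topspace X})\<^sup>+"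

definition collapse_map :: "'a topology \<Rightarrow> nat \<Rightarrow> (nat \<Rightarrow> 'a set) \<Rightarrow> 'a \<Rightarrow> 'a set" where
  "collapse_map X n A x = collapse_rel X n A `` {x}"

definition collapse_space :: "'a topology \<Rightarrow> nat \<Rightarrow> (nat \<Rightarrow> 'a set) \<Rightarrow> 'a set topology" where
  "collapse_space X n A = quotient_topology X (collapse_map X n A)"

definition loops :: "'a topology \<Rightarrow> 'a \<Rightarrow> (real \<Rightarrow> 'a) set" where
  "loops X a = {g. pathin X g \<and> g 0 = a \<and> g 1 = a \<and> g \<in> extensional {0..1}}"

text \<open>Compact-open topology: generated by the subbasis of sets {g. g(K) \<subseteq> U}, K compact
  in [0,1], U open in X.  (K = {} gives the whole loop space.)\<close>
definition loop_space :: "'a topology \<Rightarrow> 'a \<Rightarrow> (real \<Rightarrow> 'a) topology" where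
  "loop_space X a =
     topology_generated_by
       {{g \<in> loops X a. g ` K \<subseteq> U} | K U. compactin (top_of_set {0..1}) K \<and> openin X U}"

definition loop_homotopic :: "'a topology \<Rightarrow> 'a \<Rightarrow> (real \<Rightarrow> 'a) \<Rightarrow> (real \<Rightarrow> 'a) \<Rightarrow> bool" where
  "loop_homotopic X a f g \<longleftrightarrow>
     homotopic_with (\<lambda>h. h 0 = a \<and> h 1 = a) (top_of_set {0..1}) X f g"

definition loop_class :: "'a topology \<Rightarrow> 'a \<Rightarrow> (real \<Rightarrow> 'a) \<Rightarrow> (real \<Rightarrow> 'a) set" where
  "loop_class X a g = {h \<in> loops X a. loop_homotopic X a g h}"

definition pi1_top :: "'a topology \<Rightarrow> 'a \<Rightarrow> (real \<Rightarrow> 'a) set topology" where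
  "pi1_top X a = quotient_topology (loop_space X a) (loop_class X a)"

definition pi1_induced :: "'b topology \<Rightarrow> 'a \<Rightarrow> ('a \<Rightarrow> 'b) \<Rightarrow> (real \<Rightarrow> 'a) set \<Rightarrow> (real \<Rightarrow> 'b) set" where
  "pi1_induced Y a f C = loop_class Y (f a) (restrict (f \<circ> (SOME g. g \<in> C)) {0..1})"

definition condition_star :: "'a topology \<Rightarrow> nat \<Rightarrow> (nat \<Rightarrow> 'a set) \<Rightarrow> bool" where
  "condition_star X n A \<longleftrightarrow>
     (path_connected_space X \<and>
      (\<forall>i\<in>{1..n}. openin X (A i) \<and> path_connectedin X (X closure_of A i)))
   \<or> (connected_space X \<and> locally_path_connected_space X \<and> first_countable X \<and>
      (\<forall>i\<in>{1..n}. (openin X (A i) \<or> closedin X (A i)) \<and> path_connectedin X (X closure_of A i)) \<and>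
      (\<forall>i\<in>{1..n}. \<forall>j\<in>{1..n}. i \<noteq> j \<longrightarrow> disjnt (X closure_of A i) (X closure_of A j)))"

end

theory Submission
  imports Defs
begin

text \<open>The image of a compact group in a Hausdorff one is closed, so it suffices that the image of
  \<open>p\<^sub>*\<close> is dense: near every loop in the quotient there is one that is homotopic to the
  projection of a loop in \<open>X\<close>. Such a loop is assembled from short pieces of the given one, which
  is possible because all points of a fibre are exchangeable: they are joined by a path inside the
  closure of some \<open>A i\<close>, whose projection runs in the closure of a point and is therefore
  null-homotopic. If \<open>X\<close> is locally path connected, short pieces lift by moving within path
  components. If all \<open>A i\<close> are open, a short piece is followed up to its last contact with the
  collapsed points, where it may be replaced by a constant path, and lifts uniquely afterwards.\<close>

section \<open>Paths that deform into projections, and linked points\<close>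

text \<open>\<open>H\<close> deforms, relative to the end points, a path constrained by \<open>C\<close> into the projection of a
  path from \<open>x\<close> to \<open>y\<close>. The first coordinate of \<open>H\<close> is the homotopy parameter.\<close>
definition near_lift ::
  "'a topology \<Rightarrow> 'b topology \<Rightarrow> ('a \<Rightarrow> 'b) \<Rightarrow> (real \<Rightarrow> 'b set) \<Rightarrow> real \<Rightarrow> real \<Rightarrow> 'a \<Rightarrow> 'a \<Rightarrow> bool"
  where
  "near_lift X Y p C s t x y \<longleftrightarrow>
     (\<exists>H \<beta>. continuous_map (prod_topology (top_of_set {0..1}) (top_of_set {s..t})) Y H \<and>
        continuous_map (top_of_set {s..t}) X \<beta> \<and> \<beta> s = x \<and> \<beta> t = y \<and>
        (\<forall>u\<in>{s..t}. H (0, u) \<in> C u \<and> H (1, u) = p (\<beta> u)) \<and>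
        (\<forall>r\<in>{0..1::real}. H (r, s) = p x \<and> H (r, t) = p y))"

text \<open>Only the initial path of the homotopy is confined to \<open>U\<close>; the homotopy
  itself and the projected path may leave it. This weak demand suffices for density, which asks for
  a loop near the given one, and the initial path will be that loop.\<close>

definition linked ::
  "'a topology \<Rightarrow> 'b topology \<Rightarrow> ('a \<Rightarrow> 'b) \<Rightarrow> 'b set \<Rightarrow> 'a \<Rightarrow> 'a \<Rightarrow> bool" where
  "linked X Y p U x y \<longleftrightarrow> near_lift X Y p (\<lambda>_. U) 0 1 x y"

text \<open>Both homotopies are constantly \<open>p y\<close> on the seam at \<open>m\<close>, and
  both paths in \<open>X\<close> pass through the same point \<open>y\<close> there, so they can be
  pasted. The constraint \<open>C\<close> depends on the parameter so that different pieces can obey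
  different conditions.\<close>

lemma near_lift_trans:
  assumes 1: "near_lift X Y p C s m x y" and 2: "near_lift X Y p C m t y z"
    and sm: "s < m" "m < t"
  shows "near_lift X Y p C s t x z"
proof -
  let ?I = "top_of_set {0..1::real}"
  let ?J = "top_of_set {s..t}"
  obtain H \<beta> where
    H: "continuous_map (prod_topology ?I (top_of_set {s..m})) Y H"
    and \<beta>: "continuous_map (top_of_set {s..m}) X \<beta>" "\<beta> s = x" "\<beta> m = y"
    and H1: "\<And>u. u\<in>{s..m} \<Longrightarrow> H (0, u) \<in> C u \<and> H (1, u) = p (\<beta> u)"
    and H2: "\<And>r. r\<in>{0..1::real} \<Longrightarrow> H (r, s) = p x \<and> H (r, m) = p y"
    using 1 unfolding near_lift_def by blast
  obtain K \<gamma> where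
    K: "continuous_map (prod_topology ?I (top_of_set {m..t})) Y K"
    and \<gamma>: "continuous_map (top_of_set {m..t}) X \<gamma>" "\<gamma> m = y" "\<gamma> t = z"
    and K1: "\<And>u. u\<in>{m..t} \<Longrightarrow> K (0, u) \<in> C u \<and> K (1, u) = p (\<gamma> u)"
    and K2: "\<And>r. r\<in>{0..1::real} \<Longrightarrow> K (r, m) = p y \<and> K (r, t) = p z"
    using 2 unfolding near_lift_def by blast
  have L: "subtopology ?J {x \<in> topspace ?J. x \<le> m} = top_of_set {s..m}"
    and R: "subtopology ?J {x \<in> topspace ?J. m \<le> x} = top_of_set {m..t}"
    using sm by (auto simp: subtopology_subtopology intro!: arg_cong[where f = "subtopology euclidean"])
  have "continuous_map ?J X (\<lambda>u. if u \<le> m then \<beta> u else \<gamma> u)"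
  proof (rule continuous_map_cases_le)
    show "continuous_map ?J euclideanreal (\<lambda>u. u)" "continuous_map ?J euclideanreal (\<lambda>u. m)"
      by simp_all
  qed (unfold L R, use \<beta> \<gamma> in auto)
  moreover
  have L': "subtopology (prod_topology ?I ?J) {x \<in> topspace (prod_topology ?I ?J). snd x \<le> m}
      = prod_topology ?I (top_of_set {s..m})"
    and R': "subtopology (prod_topology ?I ?J) {x \<in> topspace (prod_topology ?I ?J). m \<le> snd x}
      = prod_topology ?I (top_of_set {m..t})"
    using sm by (auto simp: prod_topology_subtopology_eu subtopology_subtopology
        intro!: arg_cong[where f = "subtopology euclidean"])
  have "continuous_map (prod_topology ?I ?J) Y (\<lambda>w. if snd w \<le> m then H w else K w)"
  proof (rule continuous_map_cases_le)
    show "continuous_map (prod_topology ?I ?J) euclideanreal snd"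
      by (metis continuous_map_into_fulltopology continuous_map_snd)
    show "H w = K w" if "w \<in> topspace (prod_topology ?I ?J)" "snd w = m" for w
      using that H2 K2 by (cases w) auto
  qed (unfold L' R', use H K in auto)
  ultimately show ?thesis
    unfolding near_lift_def using sm \<beta>(2,3) \<gamma>(2,3) H1 K1 H2 K2
    by (intro exI[of _ "\<lambda>w. if snd w \<le> m then H w else K w"]
              exI[of _ "\<lambda>u. if u \<le> m then \<beta> u else \<gamma> u"]) auto
qed

lemma near_lift_mono:
  assumes "near_lift X Y p C s t x y" "\<And>u. u \<in> {s..t} \<Longrightarrow> C u \<subseteq> D u"
  shows "near_lift X Y p D s t x y"
  using assms unfolding near_lift_def by blast

text \<open>Precompose the second coordinate with \<open>\<phi>\<close>. As \<open>U\<close> does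
  not vary with the parameter, orientation may be reversed, so that one argument yields both
  rescaling and symmetry.\<close>

lemma near_lift_reparam:
  assumes "near_lift X Y p (\<lambda>_. U) s t x y"
    and \<phi>: "continuous_map (top_of_set {s'..t'}) (top_of_set {s..t}) \<phi>"
    and ends: "\<phi> s' = s \<and> \<phi> t' = t \<and> x' = x \<and> y' = y \<or> \<phi> s' = t \<and> \<phi> t' = s \<and> x' = y \<and> y' = x"
  shows "near_lift X Y p (\<lambda>_. U) s' t' x' y'"
proof -
  let ?I = "top_of_set {0..1::real}"
  obtain H \<beta> where
    H: "continuous_map (prod_topology ?I (top_of_set {s..t})) Y H"
    and \<beta>: "continuous_map (top_of_set {s..t}) X \<beta>" "\<beta> s = x" "\<beta> t = y"
    and H1: "\<And>u. u\<in>{s..t} \<Longrightarrow> H (0, u) \<in> U \<and> H (1, u) = p (\<beta> u)"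
    and H2: "\<And>r. r\<in>{0..1::real} \<Longrightarrow> H (r, s) = p x \<and> H (r, t) = p y"
    using assms(1) unfolding near_lift_def by blast
  have "continuous_map (prod_topology ?I (top_of_set {s'..t'}))
          (prod_topology ?I (top_of_set {s..t})) (\<lambda>w. (fst w, (\<phi> \<circ> snd) w))"
    by (intro continuous_map_pairedI continuous_map_fst continuous_map_compose[OF _ \<phi>] continuous_map_snd)
  note continuous_map_compose[OF this H]
  moreover have "\<phi> u \<in> {s..t}" if "u \<in> {s'..t'}" for u
    using continuous_map_funspace[OF \<phi>] that by auto
  ultimately show ?thesis
    unfolding near_lift_def using ends H1 H2 \<beta>(2,3) continuous_map_compose[OF \<phi> \<beta>(1)]
    by (intro exI[of _ "H \<circ> (\<lambda>w. (fst w, (\<phi> \<circ> snd) w))"] exI[of _ "\<beta> \<circ> \<phi>"]) auto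
qed

lemma near_lift_rescale:
  assumes "near_lift X Y p (\<lambda>_. U) s t x y" "s < t" "s' < t'"
  shows "near_lift X Y p (\<lambda>_. U) s' t' x y"
proof (rule near_lift_reparam[OF assms(1)])
  let ?k = "(t - s) / (t' - s')"
  let ?\<phi> = "\<lambda>u. s + (u - s') * ?k"
  have "?\<phi> u \<in> {s..t}" if "u \<in> {s'..t'}" for u
  proof -
    have "(u - s') * ?k \<le> (t' - s') * ?k" "0 \<le> (u - s') * ?k"
      using that assms by (intro mult_right_mono mult_nonneg_nonneg; simp)+
    moreover have "(t' - s') * ?k = t - s"
      using assms by simp
    ultimately show ?thesis by simp
  qed
  then show "continuous_map (top_of_set {s'..t'}) (top_of_set {s..t}) ?\<phi>"
    using assms by (auto intro!: continuous_intros)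
qed (use assms in auto)

lemma linked_sym:
  assumes "linked X Y p U x y"
  shows "linked X Y p U y x"
  unfolding linked_def
proof (rule near_lift_reparam[OF assms[unfolded linked_def]])
  show "continuous_map (top_of_set {0..1}) (top_of_set {0..1}) (\<lambda>u::real. 1 - u)"
    by (auto intro!: continuous_intros)
qed auto

lemma linked_trans:
  assumes "linked X Y p U x y" "linked X Y p U y z"
  shows "linked X Y p U x z"
  unfolding linked_def
proof (rule near_lift_trans)
  show "near_lift X Y p (\<lambda>_. U) 0 (1/2) x y"
    using assms(1) unfolding linked_def by (rule near_lift_rescale) auto
  show "near_lift X Y p (\<lambda>_. U) (1/2) 1 y z"
    using assms(2) unfolding linked_def by (rule near_lift_rescale) auto
qed auto

text \<open>The homotopy that is constant in its first coordinate serves.\<close>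

lemma linked_path:
  assumes p: "continuous_map X Y p" and g: "pathin X g" and U: "\<And>u. u \<in> {0..1} \<Longrightarrow> p (g u) \<in> U"
  shows "linked X Y p U (g 0) (g 1)"
  unfolding linked_def near_lift_def
proof (intro exI conjI)
  show "continuous_map (top_of_set {0..1}) X g"
    using g by (simp add: pathin_def)
  then show "continuous_map (prod_topology (top_of_set {0..1::real}) (top_of_set {0..1})) Y (p \<circ> (g \<circ> snd))"
    by (intro continuous_map_compose[OF _ p] continuous_map_compose[OF continuous_map_snd])
qed (use U in auto)

lemma linked_refl:
  assumes "continuous_map X Y p" "x \<in> topspace X" "p x \<in> U"
  shows "linked X Y p U x x"
  using linked_path[of X Y p "\<lambda>_. x" U] assms by simp

lemma path_connectedinD:
  assumes "path_connectedin X S" "x \<in> S" "y \<in> S"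
  shows "\<exists>g. pathin X g \<and> g \<in> {0..1} \<rightarrow> S \<and> g 0 = x \<and> g 1 = y"
  using assms unfolding path_connectedin by blast

section \<open>Paths in the closure of a point\<close>

text \<open>Every nonempty open subset of the closure of a point \<open>c\<close> contains \<open>c\<close>. Hence any function
  from a square to that closure is continuous if it is continuous on the boundary and equal to \<open>c\<close>
  in the interior.\<close>
lemma linked_generic_point:
  assumes p: "continuous_map X Y p" and B: "B \<subseteq> topspace X" "path_connectedin X (X closure_of B)"
    and const: "\<And>b. b \<in> B \<Longrightarrow> p b = c"
    and xy: "x \<in> X closure_of B" "y \<in> X closure_of B"
    and U: "openin Y U" "p x \<in> U" "p y \<in> U"
  shows "linked X Y p U x y"
proof -
  have closed: "p z \<in> D" if "closedin Y D" "c \<in> D" "z \<in> X closure_of B" for D z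
  proof -
    have "X closure_of B \<subseteq> {z \<in> topspace X. p z \<in> D}"
      using that B const by (intro closure_of_minimal closedin_continuous_map_preimage[OF p]) auto
    then show ?thesis using that by auto
  qed
  have cY: "c \<in> topspace Y"
  proof -
    obtain b where "b \<in> B" using xy(1) by fastforce
    then show ?thesis
      using B(1) const continuous_map_image_subset_topspace[OF p] by blast
  qed
  \<comment> \<open>By \<open>closed\<close>, \<open>p x\<close> lies in the closure of
    \<open>c\<close>, so every open neighbourhood of \<open>p x\<close> contains
    \<open>c\<close>.\<close>
  have cU: "c \<in> U"
  proof (rule ccontr)
    assume "c \<notin> U"
    then have "p x \<in> topspace Y - U"
      using closed[of "topspace Y - U" x] U xy cY by auto
    then show False using U by auto
  qed
  obtain g where g: "pathin X g" and gB: "\<And>u. u \<in> {0..1} \<Longrightarrow> g u \<in> X closure_of B"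
    and g01: "g 0 = x" "g 1 = y"
    using path_connectedinD[OF B(2) xy] by (auto simp: Pi_iff)
  have pg: "continuous_map (top_of_set {0..1}) Y (p \<circ> g)"
    using g p unfolding pathin_def by (rule continuous_map_compose)
  \<comment> \<open>The edges over the end points are constantly \<open>p x\<close> and
    \<open>p y\<close>, the final path is \<open>p \<circ> g\<close>, and everything else is
    \<open>c\<close>. In particular the initial path takes only the values \<open>p x\<close>,
    \<open>c\<close> and \<open>p y\<close>, all in \<open>U\<close>.\<close>
  define H where "H = (\<lambda>(r::real, u::real). if u = 0 then p x else if u = 1 then p y
                        else if r = 1 then p (g u) else c)"
  let ?I = "top_of_set {0..1::real}"
  have "continuous_map (prod_topology ?I ?I) Y H"
    unfolding continuous_map_closedin
  proof (intro conjI allI impI)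
    have "p z \<in> topspace Y" if "z \<in> X closure_of B" for z
      using that closed[OF closedin_topspace cY] by blast
    then show "H \<in> topspace (prod_topology ?I ?I) \<rightarrow> topspace Y"
      using cY gB xy by (auto simp: H_def)
    fix D assume D: "closedin Y D"
    show "closedin (prod_topology ?I ?I) {w \<in> topspace (prod_topology ?I ?I). H w \<in> D}"
    proof (cases "c \<in> D")
      case True
      then have "{w \<in> topspace (prod_topology ?I ?I). H w \<in> D} = topspace (prod_topology ?I ?I)"
        using closed[OF D True] gB xy by (auto simp: H_def)
      then show ?thesis by (metis closedin_topspace)
    next
      \<comment> \<open>A closed set missing \<open>c\<close> is reached only on three edges of the
        square, and on each edge its preimage is closed.\<close>
      case False
      have "closedin ?I {u \<in> {0..1}. (p \<circ> g) u \<in> D}"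
        using closedin_continuous_map_preimage[OF pg D] by simp
      moreover have "{w \<in> topspace (prod_topology ?I ?I). H w \<in> D} =
         ({1} \<times> {u \<in> {0..1}. (p \<circ> g) u \<in> D}) \<union> ({0..1} \<times> {u. u = 0 \<and> p x \<in> D}) \<union>
         ({0..1} \<times> {u. u = 1 \<and> p y \<in> D})"
        using False g01 by (auto simp: H_def split: if_splits)
      moreover have "closedin ?I {u. u = 0 \<and> p x \<in> D}" "closedin ?I {u. u = 1 \<and> p y \<in> D}"
        by (cases "p x \<in> D"; simp) (cases "p y \<in> D"; simp)
      moreover have "closedin ?I {1}" "closedin ?I {0..1}"
        using closedin_topspace[of ?I] by simp_all
      ultimately show ?thesis
        by (simp only:) (intro closedin_Un closedin_prod_Times_iff[THEN iffD2] disjI2 conjI)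
    qed
  qed
  then show ?thesis
    unfolding linked_def near_lift_def using g g01 U cU
    by (intro exI[of _ H] exI[of _ g]) (auto simp: H_def pathin_def)
qed

section \<open>Short paths in a quotient, and the locally path connected case\<close>

lemma openin_quotient_image:
  assumes q: "quotient_map X Y p" and V: "openin X V"
    and sat: "\<And>v w. \<lbrakk>v \<in> V; w \<in> topspace X; p w = p v\<rbrakk> \<Longrightarrow> w \<in> V"
  shows "openin Y (p ` V)"
proof -
  have "V \<subseteq> topspace X" using V by (rule openin_subset)
  moreover from this have "p ` V \<subseteq> topspace Y"
    using quotient_imp_surjective_map[OF q] by blast
  ultimately have "{x \<in> topspace X. p x \<in> p ` V} = V" "p ` V \<subseteq> topspace Y"
    using sat by auto
  then show ?thesis using q V unfolding quotient_map_def by metis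
qed

text \<open>This is the local form of density. The path \<open>g\<close> need not itself be
  homotopic to a projection: it may be replaced by another path in \<open>U\<close> with the same
  end points. The points above both ends are prescribed, so that consecutive pieces fit together in
  \<open>X\<close>.\<close>

definition small_paths_linked :: "'a topology \<Rightarrow> 'b topology \<Rightarrow> ('a \<Rightarrow> 'b) \<Rightarrow> bool" where
  "small_paths_linked X Y p \<longleftrightarrow>
     (\<forall>x U. x \<in> topspace X \<longrightarrow> openin Y U \<longrightarrow> p x \<in> U \<longrightarrow>
       (\<exists>V. openin Y V \<and> p x \<in> V \<and>
         (\<forall>g y. pathin Y g \<longrightarrow> g \<in> {0..1} \<rightarrow> V \<longrightarrow> g 0 = p x \<longrightarrow> g 1 = p y \<longrightarrow> y \<in> topspace X
            \<longrightarrow> linked X Y p U x y)))"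

text \<open>The points above \<open>U\<close> that are linked to \<open>x\<close> form an open set,
  because small neighbourhoods are path connected, and a saturated one, because points of a fibre
  are linked. Its image is therefore an open neighbourhood of \<open>p x\<close>, and a path ending
  there ends below a linked point.\<close>

lemma small_paths_linked_locally_path_connected:
  assumes q: "quotient_map X Y p" and lpc: "locally_path_connected_space X"
    and fibre: "\<And>x y U. \<lbrakk>x \<in> topspace X; y \<in> topspace X; p x = p y; openin Y U; p x \<in> U\<rbrakk>
                  \<Longrightarrow> linked X Y p U x y"
  shows "small_paths_linked X Y p"
  unfolding small_paths_linked_def
proof (intro allI impI)
  fix x U assume x: "x \<in> topspace X" and U: "openin Y U" "p x \<in> U"
  have p: "continuous_map X Y p" using q by (rule quotient_imp_continuous_map)
  define V where "V = {v \<in> topspace X. p v \<in> U \<and> linked X Y p U x v}"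
  have "openin X V"
  proof (subst openin_subopen, intro ballI)
    fix v assume v: "v \<in> V"
    have "openin X {v \<in> topspace X. p v \<in> U}"
      using p U openin_continuous_map_preimage by blast
    moreover have "v \<in> {v \<in> topspace X. p v \<in> U}" using v by (simp add: V_def)
    ultimately obtain W where W: "openin X W" "path_connectedin X W" "v \<in> W"
        "W \<subseteq> {v \<in> topspace X. p v \<in> U}"
      using lpc[unfolded locally_path_connected_space, rule_format, of "{v \<in> topspace X. p v \<in> U}" v]
      by blast
    have "w \<in> V" if "w \<in> W" for w
    proof -
      obtain g where g: "pathin X g" "g \<in> {0..1} \<rightarrow> W" "g 0 = v" "g 1 = w"
        using path_connectedinD[OF W(2,3) \<open>w \<in> W\<close>] by blast
      have "p (g u) \<in> U" if "u \<in> {0..1}" for u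
        using g(2) W(4) that by (auto simp: Pi_iff)
      then have "linked X Y p U v w"
        using linked_path[OF p g(1)] g(3,4) by metis
      then have "linked X Y p U x w"
        using v by (auto simp: V_def intro: linked_trans)
      then show ?thesis
        using W that by (auto simp: V_def)
    qed
    with W show "\<exists>T. openin X T \<and> v \<in> T \<and> T \<subseteq> V" by blast
  qed
  have sat: "v \<in> V" if "v \<in> topspace X" "p v \<in> p ` V" for v
  proof -
    obtain w where "w \<in> V" "p v = p w" using \<open>p v \<in> p ` V\<close> by auto
    moreover then have "linked X Y p U w v"
      using that U by (intro fibre) (auto simp: V_def)
    ultimately show ?thesis
      using that U by (auto simp: V_def intro: linked_trans)
  qed
  have "openin Y (p ` V)"
    using openin_quotient_image[OF q \<open>openin X V\<close>] sat by (metis imageI)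
  moreover have "x \<in> V" using x U linked_refl[OF p] by (simp add: V_def)
  moreover have "linked X Y p U x y"
    if "g \<in> {0..1} \<rightarrow> p ` V" "g 1 = p y" "y \<in> topspace X" for g :: "real \<Rightarrow> 'b" and y
  proof -
    have "p y \<in> p ` V" using funcset_mem[OF that(1), of 1] that(2) by simp
    then have "y \<in> V" by (rule sat[OF that(3)])
    then show ?thesis by (simp add: V_def)
  qed
  ultimately show "\<exists>V. openin Y V \<and> p x \<in> V \<and>
     (\<forall>g y. pathin Y g \<longrightarrow> g \<in> {0..1} \<rightarrow> V \<longrightarrow> g 0 = p x \<longrightarrow> g 1 = p y \<longrightarrow> y \<in> topspace X
        \<longrightarrow> linked X Y p U x y)"
    by blast
qed

section \<open>The quotient topology and the fibres of the collapse map\<close>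

lemma openin_quotient_topology:
  "openin (quotient_topology X f) U \<longleftrightarrow> U \<subseteq> f ` topspace X \<and> openin X {x \<in> topspace X. f x \<in> U}"
proof -
  have "istopology (\<lambda>U. U \<subseteq> f ` topspace X \<and> openin X {x \<in> topspace X. f x \<in> U})"
    unfolding istopology_def
  proof (intro conjI allI impI; (elim conjE)?)
    fix S T
    assume "openin X {x \<in> topspace X. f x \<in> S}" "openin X {x \<in> topspace X. f x \<in> T}"
    moreover have "{x \<in> topspace X. f x \<in> S \<inter> T}
        = {x \<in> topspace X. f x \<in> S} \<inter> {x \<in> topspace X. f x \<in> T}" by auto
    ultimately show "openin X {x \<in> topspace X. f x \<in> S \<inter> T}" by auto
  next
    fix K assume K: "\<forall>U\<in>K. U \<subseteq> f ` topspace X \<and> openin X {x \<in> topspace X. f x \<in> U}"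
    have "{x \<in> topspace X. f x \<in> \<Union>K} = (\<Union>U\<in>K. {x \<in> topspace X. f x \<in> U})" by auto
    with K show "openin X {x \<in> topspace X. f x \<in> \<Union>K}" by auto
  qed auto
  then show ?thesis
    unfolding quotient_topology_def by (simp add: topology_inverse')
qed

lemma topspace_quotient_topology: "topspace (quotient_topology X f) = f ` topspace X"
proof (rule antisym)
  have "{x \<in> topspace X. f x \<in> f ` topspace X} = topspace X" by auto
  then have "openin (quotient_topology X f) (f ` topspace X)"
    by (simp add: openin_quotient_topology)
  then show "f ` topspace X \<subseteq> topspace (quotient_topology X f)" by (rule openin_subset)
  show "topspace (quotient_topology X f) \<subseteq> f ` topspace X"
    by (rule openin_topspace[THEN openin_quotient_topology[THEN iffD1], THEN conjunct1])
qed

lemma quotient_map_quotient_topology: "quotient_map X (quotient_topology X f) f"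
  unfolding quotient_map_def by (simp add: topspace_quotient_topology openin_quotient_topology)

lemma quotient_map_collapse: "quotient_map X (collapse_space X n A) (collapse_map X n A)"
  unfolding collapse_space_def by (rule quotient_map_quotient_topology)

lemma collapse_rel_subset: "collapse_rel X n A \<subseteq> topspace X \<times> topspace X"
  unfolding collapse_rel_def by (rule trancl_subset_Sigma) auto

lemma equiv_collapse_rel: "equiv (topspace X) (collapse_rel X n A)"
proof (rule equivI)
  show "refl_on (topspace X) (collapse_rel X n A)"
    unfolding refl_on_def collapse_rel_def by (auto intro: r_into_trancl)
  show "sym (collapse_rel X n A)"
    unfolding collapse_rel_def by (rule sym_trancl) (auto simp: sym_def Id_on_def)
  show "trans (collapse_rel X n A)"
    unfolding collapse_rel_def by (rule trans_trancl)
qed (rule collapse_rel_subset)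

lemma collapse_map_eq_iff:
  assumes "x \<in> topspace X" "y \<in> topspace X"
  shows "collapse_map X n A x = collapse_map X n A y \<longleftrightarrow> (x, y) \<in> collapse_rel X n A"
  unfolding collapse_map_def by (rule eq_equiv_class_iff[OF equiv_collapse_rel assms])

lemma collapse_map_eqI:
  assumes "i \<in> {1..n}" "x \<in> A i" "y \<in> A i" "x \<in> topspace X" "y \<in> topspace X"
  shows "collapse_map X n A x = collapse_map X n A y"
  unfolding collapse_map_eq_iff[OF assms(4,5)] collapse_rel_def using assms by (blast intro: r_into_trancl)

text \<open>A chain of generating pairs that starts outside all \<open>A i\<close> can only use
  diagonal pairs.\<close>

lemma collapse_map_inj:
  assumes "x \<in> topspace X" "y \<in> topspace X" "collapse_map X n A x = collapse_map X n A y"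
    and "x \<notin> (\<Union>i\<in>{1..n}. A i)"
  shows "y = x"
proof -
  have "(x, y) \<in> collapse_rel X n A" using collapse_map_eq_iff[OF assms(1,2)] assms(3) by blast
  then show ?thesis
    unfolding collapse_rel_def
  proof (induction rule: trancl_induct)
    case (base y) then show ?case using assms(4) by auto
  next
    case (step y z) then show ?case using assms(4) by auto
  qed
qed

section \<open>Exchanging points over the closure of a collapsed point\<close>

text \<open>Points of one fibre are joined by a finite chain each of whose nontrivial steps stays in
  a single \<open>A i\<close>, and such a step is covered by \<open>linked_generic_point\<close>.
  Chains are needed because the \<open>A i\<close> may overlap.\<close>

lemma linked_collapse_fibre:
  assumes pc: "\<And>i. i \<in> {1..n} \<Longrightarrow> path_connectedin X (X closure_of A i)"
    and xy: "x \<in> topspace X" "y \<in> topspace X" "collapse_map X n A x = collapse_map X n A y"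
    and U: "openin (collapse_space X n A) U" "collapse_map X n A x \<in> U"
  shows "linked X (collapse_space X n A) (collapse_map X n A) U x y"
proof -
  let ?p = "collapse_map X n A" and ?Y = "collapse_space X n A"
  let ?R = "Id_on (topspace X) \<union>
      {(x, y). \<exists>i\<in>{1..n}. x \<in> A i \<and> y \<in> A i \<and> x \<in> topspace X \<and> y \<in> topspace X}"
  have p: "continuous_map X ?Y ?p"
    by (rule quotient_imp_continuous_map[OF quotient_map_collapse])
  have eq: "?p w = ?p v" if "(v, w) \<in> ?R" for v w
    using that
  proof
    assume "(v, w) \<in> {(x, y). \<exists>i\<in>{1..n}. x \<in> A i \<and> y \<in> A i \<and> x \<in> topspace X \<and> y \<in> topspace X}"
    then obtain i where "i \<in> {1..n}" "v \<in> A i" "w \<in> A i" "v \<in> topspace X" "w \<in> topspace X"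
      by blast
    then show ?thesis by (intro collapse_map_eqI)
  qed auto
  have link: "linked X ?Y ?p U v w" if vw: "(v, w) \<in> ?R" and v: "?p v \<in> U" for v w
  proof (cases "v = w")
    case True
    with vw v show ?thesis by (auto intro: linked_refl[OF p])
  next
    case False
    then obtain i where i: "i \<in> {1..n}" "v \<in> A i" "w \<in> A i" "v \<in> topspace X" "w \<in> topspace X"
      using vw by auto
    \<comment> \<open>\<open>A i\<close> is not assumed to lie inside the space; cutting it down
      does not change its closure.\<close>
    let ?B = "topspace X \<inter> A i"
    have eq: "?p b = ?p v" if "b \<in> ?B" for b
      using that i by (intro collapse_map_eqI[of i]) auto
    have B: "?B \<subseteq> X closure_of ?B" by (rule closure_of_subset) auto
    show ?thesis
    proof (rule linked_generic_point[OF p _ _ eq])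
      show "path_connectedin X (X closure_of ?B)"
        using pc[OF i(1)] by (simp flip: closure_of_restrict)
      show "v \<in> X closure_of ?B" "w \<in> X closure_of ?B" using i B by blast+
      show "?p w \<in> U" using eq[of w] i v by simp
    qed (use U v in auto)
  qed
  have "(x, y) \<in> ?R\<^sup>+" 
    unfolding collapse_rel_def[symmetric] using collapse_map_eq_iff[OF xy(1,2)] xy(3) by blast
  \<comment> \<open>The equality of images is carried along so that \<open>U\<close> remains a
    neighbourhood at each point of the chain.\<close>
  then have "linked X ?Y ?p U x y \<and> ?p y = ?p x"
  proof (induction rule: trancl_induct)
    case (base y)
    then show ?case using link[OF base U(2)] eq[OF base] by simp
  next
    case (step y z)
    have "?p y \<in> U" using step.IH U(2) by simp
    with step.IH show ?case
      using link[OF step.hyps(2)] eq[OF step.hyps(2)] linked_trans[of X ?Y ?p U x y z] by simp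
  qed
  then show ?thesis ..
qed

text \<open>A point above the closure of the collapsed point of \<open>A i\<close> lies in the
  closure of some \<open>A j\<close> with the same image as \<open>A i\<close>. Inside that closure
  it is linked to a point of \<open>A j\<close>, which shares its fibre with
  \<open>b\<close>.\<close>

lemma linked_collapse_closure:
  assumes op: "\<And>i. i \<in> {1..n} \<Longrightarrow> openin X (A i)"
    and pc: "\<And>i. i \<in> {1..n} \<Longrightarrow> path_connectedin X (X closure_of A i)"
    and i: "i \<in> {1..n}" "b \<in> A i"
    and z: "z \<in> topspace X"
      "collapse_map X n A z \<in> collapse_space X n A closure_of (collapse_map X n A ` A i)"
    and U: "openin (collapse_space X n A) U" "collapse_map X n A z \<in> U"
  shows "linked X (collapse_space X n A) (collapse_map X n A) U z b"
proof -
  let ?p = "collapse_map X n A" and ?Y = "collapse_space X n A"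
  note q = quotient_map_collapse[of X n A]
  note p = quotient_imp_continuous_map[OF q]
  have sub: "A k \<subseteq> topspace X" if "k \<in> {1..n}" for k
    using op[OF that] by (rule openin_subset)
  have im: "?p ` A k = {?p w}" if "k \<in> {1..n}" "w \<in> A k" for k w
  proof -
    have "?p v = ?p w" if "v \<in> A k" for v
      using collapse_map_eqI[where A = A and i = k, OF \<open>k \<in> {1..n}\<close> that \<open>w \<in> A k\<close>] sub[OF \<open>k \<in> {1..n}\<close>] that \<open>w \<in> A k\<close> by blast
    then show ?thesis using \<open>w \<in> A k\<close> by blast
  qed
  \<comment> \<open>\<open>A i\<close> has the single image \<open>?p b\<close>, which lies in every
    neighbourhood of a point of its closure.\<close>
  have pb: "?p b \<in> U"
  proof -
    obtain c where "c \<in> ?p ` A i" "c \<in> U" using z(2) U unfolding in_closure_of by blast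
    then show ?thesis using im[OF i] by simp
  qed
  define J where "J = {j \<in> {1..n}. ?p ` A j = ?p ` A i}"
  have "\<exists>j\<in>J. z \<in> X closure_of A j"
  proof (rule ccontr)
    assume neg: "\<not> (\<exists>j\<in>J. z \<in> X closure_of A j)"
    define V where "V = topspace X - (\<Union>j\<in>J. X closure_of A j)"
    \<comment> \<open>A saturated open neighbourhood of \<open>z\<close> that misses
      \<open>A i\<close> is sought. With the remaining \<open>A j\<close> adjoined, saturation is
      easy to see: a fibre meeting \<open>W\<close> is a single point or is made of points in sets
      \<open>A j\<close> with \<open>j\<close> outside \<open>J\<close>.\<close>
    define W where "W = V \<union> (\<Union>j\<in>{1..n} - J. A j)"
    have "openin X V"
      unfolding V_def J_def by (intro openin_diff openin_topspace closedin_Union) auto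
    then have "openin X W"
      unfolding W_def by (intro openin_Un openin_Union) (use op in auto)
    have memJ: "k \<in> J" if "k \<in> {1..n}" "w \<in> A k" "j \<in> J" "v \<in> A j" "?p v = ?p w" for k w j v
      using im[OF that(1,2)] im[of j v] that unfolding J_def by simp
    have WJ: "k \<notin> J" if w: "w \<in> W" and k: "k \<in> {1..n}" "w \<in> A k" for w k
    proof
      assume kJ: "k \<in> J"
      have "w \<in> X closure_of A k"
        using closure_of_subset[OF sub[OF k(1)]] k(2) by blast
      then have "w \<notin> V" using kJ by (auto simp: V_def)
      then obtain j where j: "j \<in> {1..n}" "j \<notin> J" "w \<in> A j" using w by (auto simp: W_def)
      then show False using memJ[OF j(1,3) kJ k(2)] by simp
    qed
    have sat: "w' \<in> W" if w: "w \<in> W" and w': "w' \<in> topspace X" "?p w' = ?p w" for w w'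
    proof -
      have wX: "w \<in> topspace X" using w \<open>openin X W\<close> openin_subset by blast
      show ?thesis
      proof (cases "w' \<in> (\<Union>k\<in>{1..n}. A k)")
        case False
        then have "w = w'" using collapse_map_inj[OF w'(1) wX w'(2)] by blast
        with w show ?thesis by simp
      next
        case True
        then obtain l where l: "l \<in> {1..n}" "w' \<in> A l" by blast
        show ?thesis
        proof (cases "w \<in> (\<Union>k\<in>{1..n}. A k)")
          case False
          then have "w' = w" using collapse_map_inj[OF wX w'(1) w'(2)[symmetric]] by blast
          with w show ?thesis by simp
        next
          case True
          then obtain k where k: "k \<in> {1..n}" "w \<in> A k" by blast
          have "l \<notin> J" using memJ[OF k _ l(2) w'(2)] WJ[OF w k] by blast
          then show ?thesis using l by (auto simp: W_def)
        qed
      qed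
    qed
    have "openin ?Y (?p ` W)"
      by (rule openin_quotient_image[OF q \<open>openin X W\<close> sat])
    moreover have "z \<in> W" using neg z(1) by (simp add: W_def V_def)
    ultimately obtain c where c: "c \<in> A i" "?p c \<in> ?p ` W"
      using z(2) unfolding in_closure_of by blast
    then obtain w where "w \<in> W" "?p c = ?p w" by blast
    then have "c \<in> W" using sat[of w c] sub[OF i(1)] c(1) by blast
    moreover have "i \<in> J" using i by (simp add: J_def)
    ultimately show False using WJ[OF _ i(1) c(1)] by blast
  qed
  then obtain j where j: "j \<in> J" "z \<in> X closure_of A j" by blast
  then have jn: "j \<in> {1..n}" by (simp add: J_def)
  obtain v where v: "v \<in> A j" using j(2) unfolding in_closure_of by blast
  have vb: "?p v = ?p b" using im[OF jn v] im[OF i] j(1) by (simp add: J_def)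
  have "linked X ?Y ?p U z v"
  proof (rule linked_generic_point[OF p sub[OF jn] pc[OF jn] _ j(2) _ U])
    show "?p w = ?p v" if "w \<in> A j" for w using im[OF jn v] that by blast
    show "v \<in> X closure_of A j" using closure_of_subset[OF sub[OF jn]] v by blast
    show "?p v \<in> U" using vb pb by simp
  qed
  moreover have "linked X ?Y ?p U v b"
    using v vb pb sub[OF jn] sub[OF i(1)] i(2) by (intro linked_collapse_fibre pc U) auto
  ultimately show ?thesis by (rule linked_trans)
qed

section \<open>Short paths when all \<open>A i\<close> are open\<close>

text \<open>Away from the collapsed points the path has a unique lift \<open>h\<close>. It is
  continuous because \<open>V \<union> S\<close> is open and saturated for every open
  \<open>V\<close>, and adding \<open>S\<close> does not affect the preimage, as \<open>h\<close>
  avoids \<open>S\<close>.\<close>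

lemma linked_collapse_lift:
  assumes op: "\<And>i. i \<in> {1..n} \<Longrightarrow> openin X (A i)"
    and g: "pathin (collapse_space X n A) g" "g \<in> {0..1} \<rightarrow> U"
    and out: "\<And>u. u \<in> {0..1} \<Longrightarrow> g u \<notin> collapse_map X n A ` (\<Union>i\<in>{1..n}. A i)"
    and ends: "x \<in> topspace X" "collapse_map X n A x = g 0"
      "y \<in> topspace X" "collapse_map X n A y = g 1"
  shows "linked X (collapse_space X n A) (collapse_map X n A) U x y"
proof -
  let ?p = "collapse_map X n A" and ?Y = "collapse_space X n A"
  define S where "S = (\<Union>i\<in>{1..n}. A i)"
  note q = quotient_map_collapse[of X n A]
  note p = quotient_imp_continuous_map[OF q]
  have S: "openin X S" unfolding S_def using op by blast
  have inj: "w = v" if "v \<in> topspace X" "w \<in> topspace X" "?p v = ?p w" "v \<notin> S" for v w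
    using collapse_map_inj[OF that(1-3)] that(4) unfolding S_def by blast
  define h where "h u = inv_into (topspace X) ?p (g u)" for u
  have h: "h u \<in> topspace X" "?p (h u) = g u" "h u \<notin> S" if "u \<in> {0..1}" for u
  proof -
    have "g u \<in> ?p ` topspace X"
      using path_image_subset_topspace[OF g(1)] that quotient_imp_surjective_map[OF q] by blast
    then show "h u \<in> topspace X" "?p (h u) = g u"
      unfolding h_def by (rule inv_into_into, rule f_inv_into_f)
    then show "h u \<notin> S" using out[OF that] unfolding S_def by fastforce
  qed
  have "pathin X h"
    unfolding pathin_def continuous_map_def
  proof (intro conjI allI impI)
    show "h \<in> topspace (top_of_set {0..1}) \<rightarrow> topspace X" using h by auto
    fix V assume V: "openin X V"
    have VX: "V \<subseteq> topspace X" using V by (rule openin_subset)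
    have "openin ?Y (?p ` (V \<union> S))"
    proof (rule openin_quotient_image[OF q])
      show "openin X (V \<union> S)" using V S by blast
      fix v w assume vw: "v \<in> V \<union> S" "w \<in> topspace X" "?p w = ?p v"
      moreover have "v \<in> topspace X" using vw openin_subset[OF S] VX by blast
      ultimately show "w \<in> V \<union> S" using inj[of w v] by blast
    qed
    then have "openin (top_of_set {0..1}) {u \<in> topspace (top_of_set {0..1}). g u \<in> ?p ` (V \<union> S)}"
      using g(1) unfolding pathin_def by (intro openin_continuous_map_preimage)
    moreover have "h u \<in> V \<longleftrightarrow> g u \<in> ?p ` (V \<union> S)" if u: "u \<in> {0..1}" for u
    proof
      assume "h u \<in> V" then show "g u \<in> ?p ` (V \<union> S)" using h(2)[OF u] by force
    next
      assume "g u \<in> ?p ` (V \<union> S)"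
      then obtain v where v: "v \<in> V \<union> S" "g u = ?p v" by blast
      then have "v \<in> topspace X" using openin_subset[OF S] VX by blast
      then have "v = h u" using inj[OF h(1)[OF u] _ _ h(3)[OF u]] h(2)[OF u] v(2) by simp
      then show "h u \<in> V" using v(1) h(3)[OF u] by blast
    qed
    ultimately show "openin (top_of_set {0..1}) {u \<in> topspace (top_of_set {0..1}). h u \<in> V}"
      by (simp cong: conj_cong)
  qed
  moreover have "?p (h u) \<in> U" if "u \<in> {0..1}" for u
    using h(2)[OF that] g(2) that by (simp add: Pi_iff)
  ultimately have "linked X ?Y ?p U (h 0) (h 1)"
    by (rule linked_path[OF p])
  moreover have "x = h 0" using inj[OF h(1) ends(1) _ h(3)] h(2)[of 0] ends(2) by simp
  moreover have "y = h 1" using inj[OF h(1) ends(3) _ h(3)] h(2)[of 1] ends(4) by simp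
  ultimately show ?thesis by simp
qed

text \<open>Let \<open>t\<close> be the last accumulation time of the visits to collapsed points.
  Then \<open>g t\<close> is in the closure of some collapsed point, and \<open>V\<close> is chosen
  so that \<open>?p x\<close> is in the same closure. Hence \<open>x\<close> and a point
  \<open>z\<close> above \<open>g t\<close> are linked through a point of \<open>A i\<close>, and
  the rest of the path lifts from \<open>z\<close> to \<open>y\<close>.\<close>

lemma small_paths_linked_open:
  assumes op: "\<And>i. i \<in> {1..n} \<Longrightarrow> openin X (A i)"
    and pc: "\<And>i. i \<in> {1..n} \<Longrightarrow> path_connectedin X (X closure_of A i)"
  shows "small_paths_linked X (collapse_space X n A) (collapse_map X n A)"
  unfolding small_paths_linked_def
proof (intro allI impI)
  let ?p = "collapse_map X n A" and ?Y = "collapse_space X n A"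
  let ?I = "top_of_set {0..1::real}"
  fix x U assume x: "x \<in> topspace X" and U: "openin ?Y U" "?p x \<in> U"
  define S where "S = (\<Union>i\<in>{1..n}. A i)"
  note q = quotient_map_collapse[of X n A]
  note p = quotient_imp_continuous_map[OF q]
  have S: "openin X S" unfolding S_def using op by blast
  have pS: "openin ?Y (?p ` S)"
  proof (rule openin_quotient_image[OF q S])
    fix v w assume vw: "v \<in> S" "w \<in> topspace X" "?p w = ?p v"
    moreover have "v \<in> topspace X" using vw(1) openin_subset[OF S] by blast
    ultimately show "w \<in> S" using collapse_map_inj[of w X v n A] unfolding S_def by blast
  qed
  define J where "J = {i \<in> {1..n}. ?p x \<notin> ?Y closure_of (?p ` A i)}"
  define V where "V = U - (\<Union>i\<in>J. ?Y closure_of (?p ` A i))"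
  have "openin ?Y V"
    unfolding V_def J_def by (intro openin_diff U closedin_Union) auto
  moreover have "?p x \<in> V" using U by (simp add: V_def J_def)
  moreover have "linked X ?Y ?p U x y"
    if g: "pathin ?Y g" "g \<in> {0..1} \<rightarrow> V" "g 0 = ?p x" "g 1 = ?p y" and y: "y \<in> topspace X" for g y
  proof -
    have gU: "g u \<in> U" if "u \<in> {0..1}" for u
      using g(2) that by (auto simp: V_def)
    define T where "T = {u \<in> {0..1}. g u \<in> ?p ` S}"
    have "openin ?I {u \<in> topspace ?I. g u \<in> ?p ` S}"
      using g(1) pS unfolding pathin_def by (rule openin_continuous_map_preimage)
    then have T: "openin ?I T" by (simp add: T_def)
    show ?thesis
    proof (cases "T = {}")
      case True
      then show ?thesis
        using g gU x y by (intro linked_collapse_lift[where g = g] op) (auto simp: T_def S_def)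
    next
      case False
      define t where "t = Sup T"
      have bdd: "bdd_above T" by (auto simp: T_def)
      have tc: "t \<in> closure T" unfolding t_def by (rule closure_contains_Sup[OF False bdd])
      moreover have "closure T \<subseteq> {0..1}" by (rule closure_minimal) (auto simp: T_def)
      ultimately have t: "t \<in> {0..1}" by blast
      have out: "u \<notin> T" if "t < u" for u
        using cSup_upper[OF _ bdd, of u] that by (auto simp: t_def)
      have "{0..1} \<inter> T = T" by (auto simp: T_def)
      then have "t \<in> ?I closure_of T"
        using tc t by (simp add: closure_of_subtopology)
      then have "g t \<in> ?Y closure_of (g ` T)"
        using continuous_map_image_closure_subset[OF g(1)[unfolded pathin_def], of T] by blast
      moreover have "?Y closure_of (g ` T) \<subseteq> ?Y closure_of (\<Union>i\<in>{1..n}. ?p ` A i)"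
        by (rule closure_of_mono) (auto simp: T_def S_def)
      \<comment> \<open>The union is finite, so its closure is the union of the closures and one
        index can be singled out.\<close>
      ultimately obtain i where i: "i \<in> {1..n}" "g t \<in> ?Y closure_of (?p ` A i)"
        by (auto simp: closure_of_Union)
      \<comment> \<open>The closures subtracted in \<open>V\<close> are those that do not contain
        \<open>?p x\<close>; since \<open>g t\<close> lies in \<open>V\<close>, index
        \<open>i\<close> is not among them.\<close>
      then have px: "?p x \<in> ?Y closure_of (?p ` A i)"
        using funcset_mem[OF g(2) t] by (auto simp: V_def J_def)
      obtain b where b: "b \<in> A i" using i(2) unfolding in_closure_of by blast
      have "g t \<in> topspace ?Y" using path_image_subset_topspace[OF g(1)] t by blast
      then obtain z where z: "z \<in> topspace X" "?p z = g t"
        using quotient_imp_surjective_map[OF q] by (metis imageE)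
      have xb: "linked X ?Y ?p U x b"
        by (rule linked_collapse_closure[OF op pc i(1) b x px U])
      have zb: "linked X ?Y ?p U z b"
        using i(2) z(2) gU[OF t] by (intro linked_collapse_closure[OF op pc i(1) b z(1) _ U(1)]) auto
      have zy: "linked X ?Y ?p U z y"
      proof (cases "t = 1")
        case True
        then show ?thesis
          using z g(4) gU[OF t] y by (intro linked_collapse_fibre pc U) auto
      next
        case False
        \<comment> \<open>\<open>T\<close> is relatively open and \<open>t < 1\<close>, so a
          supremum belonging to \<open>T\<close> would be exceeded inside \<open>T\<close>.\<close>
        have tT: "t \<notin> T"
        proof
          assume "t \<in> T"
          then obtain e where e: "e > 0" "\<And>u. u \<in> {0..1} \<Longrightarrow> dist u t < e \<Longrightarrow> u \<in> T"
            using T unfolding openin_euclidean_subtopology_iff by blast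
          have "min 1 (t + e/2) \<in> T"
            using e(1) t by (intro e(2)) (auto simp: dist_real_def)
          moreover have "t < min 1 (t + e/2)" using e(1) t False by auto
          ultimately show False using out by blast
        qed
        have seg: "t + (1 - t) * u \<in> {0..1}" "t \<le> t + (1 - t) * u" if "u \<in> {0..1}" for u
        proof -
          have "(1 - t) * u \<le> 1 - t" "0 \<le> (1 - t) * u"
            using that t by (auto intro: mult_left_le)
          then show "t + (1 - t) * u \<in> {0..1}" "t \<le> t + (1 - t) * u" using t by auto
        qed
        \<comment> \<open>The tail of \<open>g\<close> after time \<open>t\<close>, rescaled to the
          unit interval.\<close>
        have path: "pathin ?Y (g \<circ> (\<lambda>u. t + (1 - t) * u))"
          using g(1) unfolding pathin_def
          by (rule continuous_map_compose[rotated]) (use seg in \<open>auto intro!: continuous_intros\<close>)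
        have outS: "g (t + (1 - t) * u) \<notin> ?p ` S" if "u \<in> {0..1}" for u
        proof -
          have "t + (1 - t) * u \<notin> T"
            using out[of "t + (1 - t) * u"] tT seg(2)[OF that] by (cases "t = t + (1 - t) * u") auto
          then show ?thesis using seg(1)[OF that] by (simp add: T_def)
        qed
        show ?thesis
        proof (rule linked_collapse_lift[OF op path _ _ z(1) _ y])
          show "g \<circ> (\<lambda>u. t + (1 - t) * u) \<in> {0..1} \<rightarrow> U"
            using gU[OF seg(1)] by (simp add: Pi_iff)
          show "(g \<circ> (\<lambda>u. t + (1 - t) * u)) u \<notin> ?p ` (\<Union>i\<in>{1..n}. A i)" if "u \<in> {0..1}" for u
            using outS[OF that] by (simp add: S_def)
        qed (use z(2) g(4) in simp_all)
      qed
      show ?thesis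
        by (rule linked_trans[OF xb linked_trans[OF linked_sym[OF zb] zy]])
    qed
  qed
  ultimately show "\<exists>V. openin ?Y V \<and> ?p x \<in> V \<and>
     (\<forall>g y. pathin ?Y g \<longrightarrow> g \<in> {0..1} \<rightarrow> V \<longrightarrow> g 0 = ?p x \<longrightarrow> g 1 = ?p y \<longrightarrow> y \<in> topspace X
        \<longrightarrow> linked X ?Y ?p U x y)"
    by blast
qed

section \<open>Loop spaces, homotopy classes and the induced map\<close>

lemma topspace_loop_space: "topspace (loop_space X a) = loops X a"
proof -
  have "loops X a = {g \<in> loops X a. g ` {} \<subseteq> {}}" by simp
  then have "loops X a \<in> {{g \<in> loops X a. g ` K \<subseteq> U} | K U. compactin (top_of_set {0..1}) K \<and> openin X U}"
    using compactin_empty openin_empty by blast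
  then show ?thesis
    unfolding loop_space_def topology_generated_by_topspace by blast
qed

lemma topspace_pi1_top: "topspace (pi1_top X a) = loop_class X a ` loops X a"
  by (simp add: pi1_top_def topspace_quotient_topology topspace_loop_space)

lemma loops_restrict:
  assumes "continuous_map (top_of_set {0..1}) X g" "g 0 = a" "g 1 = a"
  shows "restrict g {0..1} \<in> loops X a"
  using assms continuous_map_eq[OF assms(1), of "restrict g {0..1}"]
  by (auto simp: loops_def pathin_def)

lemma loop_homotopic_trans:
  "\<lbrakk>loop_homotopic X a f g; loop_homotopic X a g h\<rbrakk> \<Longrightarrow> loop_homotopic X a f h"
  unfolding loop_homotopic_def by (rule homotopic_with_trans)

lemma loop_homotopic_sym: "loop_homotopic X a f g \<Longrightarrow> loop_homotopic X a g f"
  unfolding loop_homotopic_def by (rule homotopic_with_symD)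

lemma loop_class_eqI:
  assumes "loop_homotopic X a f g"
  shows "loop_class X a f = loop_class X a g"
proof -
  have "loop_homotopic X a f h \<longleftrightarrow> loop_homotopic X a g h" for h
    using loop_homotopic_trans[OF assms] loop_homotopic_trans[OF loop_homotopic_sym[OF assms]] by blast
  then show ?thesis by (simp add: loop_class_def)
qed

lemma loop_class_self: "f \<in> loops X a \<Longrightarrow> f \<in> loop_class X a f"
  by (simp add: loop_class_def loop_homotopic_def loops_def pathin_def)

lemma loop_homotopic_compose:
  assumes p: "continuous_map X Y p" and h: "loop_homotopic X a f g"
  shows "loop_homotopic Y (p a) (restrict (p \<circ> f) {0..1}) (restrict (p \<circ> g) {0..1})"
proof -
  let ?P = "\<lambda>h. h (0::real) = p a \<and> h 1 = p a"
  have hom: "homotopic_with ?P (top_of_set {0..1}) Y (p \<circ> f) (p \<circ> g)"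
    using h unfolding loop_homotopic_def
    by (rule homotopic_with_compose_continuous_map_left) (use p in auto)
  show ?thesis
    unfolding loop_homotopic_def
    by (rule homotopic_with_eq[OF hom]) auto
qed

text \<open>The representative picked by \<open>SOME\<close> is homotopic to \<open>f\<close>, and
  composition with \<open>p\<close> preserves homotopy.\<close>

lemma pi1_induced_loop_class:
  assumes p: "continuous_map X Y p" and f: "f \<in> loops X a"
  shows "pi1_induced Y a p (loop_class X a f) = loop_class Y (p a) (restrict (p \<circ> f) {0..1})"
proof -
  have "(SOME g. g \<in> loop_class X a f) \<in> loop_class X a f"
    unfolding some_in_eq using loop_class_self[OF f] by blast
  then have "loop_homotopic X a f (SOME g. g \<in> loop_class X a f)"
    by (simp add: loop_class_def)
  from loop_class_eqI[OF loop_homotopic_compose[OF p this]] show ?thesis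
    by (simp add: pi1_induced_def)
qed

lemma loops_compose:
  assumes "continuous_map X Y p" "f \<in> loops X a"
  shows "restrict (p \<circ> f) {0..1} \<in> loops Y (p a)"
  using assms by (intro loops_restrict) (auto simp: loops_def pathin_def intro: continuous_map_compose)

text \<open>The preimage of the subbasic set given by \<open>K\<close> and \<open>U\<close> is the
  one given by \<open>K\<close> and the preimage of \<open>U\<close> under \<open>p\<close>.\<close>

lemma continuous_map_loop_space:
  assumes p: "continuous_map X Y p"
  shows "continuous_map (loop_space X a) (loop_space Y (p a)) (\<lambda>f. restrict (p \<circ> f) {0..1})"
  unfolding loop_space_def[of Y]
proof (rule continuous_on_generated_topo)
  let ?F = "\<lambda>f. restrict (p \<circ> f) {0..1::real}"
  fix W assume "W \<in> {{g \<in> loops Y (p a). g ` K \<subseteq> U} | K U. compactin (top_of_set {0..1}) K \<and> openin Y U}"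
  then obtain K U where W: "W = {g \<in> loops Y (p a). g ` K \<subseteq> U}"
    and K: "compactin (top_of_set {0..1}) K" and U: "openin Y U" by blast
  have K01: "K \<subseteq> {0..1}" using compactin_subset_topspace[OF K] by simp
  have "?F -` W \<inter> topspace (loop_space X a) = {g \<in> loops X a. g ` K \<subseteq> {x \<in> topspace X. p x \<in> U}}"
  proof (intro set_eqI iffI)
    fix g assume g: "g \<in> ?F -` W \<inter> topspace (loop_space X a)"
    then have gl: "g \<in> loops X a" by (simp add: topspace_loop_space)
    then have "g u \<in> topspace X" if "u \<in> {0..1}" for u
      using path_image_subset_topspace[of X g] that unfolding loops_def by blast
    moreover have "p (g u) \<in> U" if "u \<in> K" for u
    proof -
      have "?F g u \<in> U" using g that W by auto
      moreover have "u \<in> {0..1}" using that K01 by blast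
      ultimately show ?thesis by simp
    qed
    ultimately show "g \<in> {g \<in> loops X a. g ` K \<subseteq> {x \<in> topspace X. p x \<in> U}}"
      using gl K01 by auto
  next
    fix g assume "g \<in> {g \<in> loops X a. g ` K \<subseteq> {x \<in> topspace X. p x \<in> U}}"
    then show "g \<in> ?F -` W \<inter> topspace (loop_space X a)"
      using K01 loops_compose[OF p, of g a] W by (auto simp: topspace_loop_space image_subset_iff)
  qed
  moreover have "openin (loop_space X a) {g \<in> loops X a. g ` K \<subseteq> {x \<in> topspace X. p x \<in> U}}"
    unfolding loop_space_def using K openin_continuous_map_preimage[OF p U]
    by (intro topology_generated_by_Basis) blast
  ultimately show "openin (loop_space X a) (?F -` W \<inter> topspace (loop_space X a))" by simp
next
  show "(\<lambda>f. restrict (p \<circ> f) {0..1}) ` topspace (loop_space X a) \<subseteq>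
     \<Union> {{g \<in> loops Y (p a). g ` K \<subseteq> U} | K U. compactin (top_of_set {0..1}) K \<and> openin Y U}"
    using topspace_loop_space[of Y "p a"] loops_compose[OF p]
    unfolding loop_space_def[of Y] topology_generated_by_topspace
    by (auto simp only: topspace_loop_space)
qed

lemma continuous_map_pi1_induced:
  assumes p: "continuous_map X Y p"
  shows "continuous_map (pi1_top X a) (pi1_top Y (p a)) (pi1_induced Y a p)"
  unfolding pi1_top_def[of X]
proof (rule continuous_compose_quotient_map[OF quotient_map_quotient_topology])
  have "continuous_map (loop_space X a) (pi1_top Y (p a)) (loop_class Y (p a) \<circ> (\<lambda>f. restrict (p \<circ> f) {0..1}))"
    unfolding pi1_top_def
    by (rule continuous_map_compose[OF continuous_map_loop_space[OF p]
          quotient_imp_continuous_map[OF quotient_map_quotient_topology]])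
  then show "continuous_map (loop_space X a) (pi1_top Y (p a)) (pi1_induced Y a p \<circ> loop_class X a)"
    by (rule continuous_map_eq) (simp add: topspace_loop_space pi1_induced_loop_class[OF p])
qed

section \<open>Neighbourhoods in the compact-open topology\<close>

text \<open>Equivalently, the pairs \<open>(u, y)\<close> with \<open>y \<in> C u\<close> form a
  neighbourhood of the graph of \<open>\<alpha>\<close> in the product of the unit interval with
  \<open>Y\<close>.\<close>

definition tube :: "'b topology \<Rightarrow> (real \<Rightarrow> 'b) \<Rightarrow> (real \<Rightarrow> 'b set) \<Rightarrow> bool" where
  "tube Y \<alpha> C \<longleftrightarrow> (\<forall>x\<in>{0..1}. \<exists>U d. openin Y U \<and> \<alpha> x \<in> U \<and> d > 0 \<and>
                     (\<forall>u\<in>{0..1}. \<bar>u - x\<bar> < d \<longrightarrow> U \<subseteq> C u))"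

lemma tube_Int:
  assumes "tube Y \<alpha> C" "tube Y \<alpha> D"
  shows "tube Y \<alpha> (\<lambda>u. C u \<inter> D u)"
  unfolding tube_def
proof
  fix x :: real assume x: "x \<in> {0..1}"
  obtain U d where U: "openin Y U" "\<alpha> x \<in> U" "d > 0" "\<forall>u\<in>{0..1}. \<bar>u - x\<bar> < d \<longrightarrow> U \<subseteq> C u"
    using assms(1) x unfolding tube_def by blast
  obtain V e where V: "openin Y V" "\<alpha> x \<in> V" "e > 0" "\<forall>u\<in>{0..1}. \<bar>u - x\<bar> < e \<longrightarrow> V \<subseteq> D u"
    using assms(2) x unfolding tube_def by blast
  have "openin Y (U \<inter> V) \<and> \<alpha> x \<in> U \<inter> V \<and> min d e > 0 \<and>
      (\<forall>u\<in>{0..1}. \<bar>u - x\<bar> < min d e \<longrightarrow> U \<inter> V \<subseteq> C u \<inter> D u)"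
    using U V by auto
  then show "\<exists>U d. openin Y U \<and> \<alpha> x \<in> U \<and> d > 0 \<and>
      (\<forall>u\<in>{0..1}. \<bar>u - x\<bar> < d \<longrightarrow> U \<subseteq> C u \<inter> D u)"
    by blast
qed

text \<open>Induction over the generation of the open set. For a subbasic set, impose
  \<open>U\<close> on \<open>K\<close> and nothing elsewhere; this is a tube because
  \<open>K\<close> is closed, so that a point off \<open>K\<close> has a ball avoiding
  \<open>K\<close>.\<close>

lemma loop_space_neighbourhood:
  assumes "openin (loop_space Y b) W" "\<alpha> \<in> W"
  shows "\<exists>C. tube Y \<alpha> C \<and> (\<forall>g\<in>loops Y b. (\<forall>u\<in>{0..1}. g u \<in> C u) \<longrightarrow> g \<in> W)"
  using openin_topology_generated_by[OF assms(1)[unfolded loop_space_def]] assms(2)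
proof (induction rule: generate_topology_on.induct)
  case Empty
  then show ?case by simp
next
  case (Int V W)
  then have "\<alpha> \<in> V" "\<alpha> \<in> W" by auto
  from Int.IH(1)[OF this(1)] Int.IH(2)[OF this(2)] obtain C D
    where "tube Y \<alpha> C" "tube Y \<alpha> D"
      and *: "\<forall>g\<in>loops Y b. (\<forall>u\<in>{0..1}. g u \<in> C u) \<longrightarrow> g \<in> V"
        "\<forall>g\<in>loops Y b. (\<forall>u\<in>{0..1}. g u \<in> D u) \<longrightarrow> g \<in> W"
    by (elim exE conjE)
  then have "tube Y \<alpha> (\<lambda>u. C u \<inter> D u)" by (intro tube_Int)
  moreover have "g \<in> V \<inter> W" if "g \<in> loops Y b" "\<forall>u\<in>{0..1}. g u \<in> C u \<inter> D u" for g
    using * that by simp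
  ultimately show ?case by (intro exI[of _ "\<lambda>u. C u \<inter> D u"]) simp
next
  case (UN K)
  then obtain k where k: "k \<in> K" "\<alpha> \<in> k" by blast
  from UN.IH[OF k] obtain C where "tube Y \<alpha> C"
      "\<forall>g\<in>loops Y b. (\<forall>u\<in>{0..1}. g u \<in> C u) \<longrightarrow> g \<in> k"
    by (elim exE conjE)
  with k(1) show ?case by (intro exI[of _ C] conjI ballI impI UnionI[of k]) simp_all
next
  case (Basis W)
  then obtain K U where W: "W = {g \<in> loops Y b. g ` K \<subseteq> U}"
    and K: "compactin (top_of_set {0..1}) K" and U: "openin Y U" by blast
  have K01: "K \<subseteq> {0..1}" using compactin_subset_topspace[OF K] by simp
  have "closed K" using K by (simp add: compactin_subtopology compact_imp_closed)
  have \<alpha>: "\<alpha> \<in> loops Y b" "\<alpha> ` K \<subseteq> U" using Basis W by auto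
  let ?C = "\<lambda>u. if u \<in> K then U else topspace Y"
  have "\<exists>V d. openin Y V \<and> \<alpha> x \<in> V \<and> d > 0 \<and> (\<forall>u\<in>{0..1}. \<bar>u - x\<bar> < d \<longrightarrow> V \<subseteq> ?C u)"
    if x: "x \<in> {0..1}" for x
  proof (cases "x \<in> K")
    case True
    \<comment> \<open>The radius 1 is arbitrary, since \<open>U\<close> lies in both possible values
      of \<open>?C\<close>.\<close>
    then have "openin Y U \<and> \<alpha> x \<in> U \<and> (1::real) > 0 \<and> (\<forall>u\<in>{0..1}. \<bar>u - x\<bar> < 1 \<longrightarrow> U \<subseteq> ?C u)"
      using U \<alpha> openin_subset[OF U] by auto
    then show ?thesis by blast
  next
    case False
    then obtain d where d: "d > 0" "ball x d \<subseteq> - K"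
      using openE[OF open_Compl[OF \<open>closed K\<close>], of x] by blast
    have "\<alpha> x \<in> topspace Y"
      using \<alpha>(1) x path_image_subset_topspace[of Y \<alpha>] unfolding loops_def by blast
    moreover have "u \<notin> K" if "\<bar>u - x\<bar> < d" for u
      using subsetD[OF d(2), of u] that by (auto simp: dist_real_def abs_minus_commute)
    ultimately have "openin Y (topspace Y) \<and> \<alpha> x \<in> topspace Y \<and> d > 0 \<and>
        (\<forall>u\<in>{0..1}. \<bar>u - x\<bar> < d \<longrightarrow> topspace Y \<subseteq> ?C u)"
      using d by simp
    then show ?thesis by blast
  qed
  moreover have "g \<in> W" if "g \<in> loops Y b" "\<forall>u\<in>{0..1}. g u \<in> ?C u" for g
  proof -
    have "g u \<in> U" if "u \<in> K" for u
      using that K01 \<open>\<forall>u\<in>{0..1}. g u \<in> ?C u\<close> by (auto dest: bspec[of _ _ u])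
    then show ?thesis using that(1) unfolding W by blast
  qed
  ultimately show ?case by (intro exI[of _ ?C]) (simp add: tube_def)
qed

section \<open>From short paths to loops, and density of the image\<close>

text \<open>The bisection principle \<open>Bolzano\<close> reduces the claim to short intervals
  around each parameter, where \<open>small_paths_linked\<close> applies, and to the gluing of
  adjacent intervals.\<close>

lemma near_lift_loop:
  assumes sp: "small_paths_linked X Y p" and surj: "p ` topspace X = topspace Y"
    and \<alpha>: "pathin Y \<alpha>"
    and C: "tube Y \<alpha> C"
    and ends: "a \<in> topspace X" "p a = \<alpha> 0" "b \<in> topspace X" "p b = \<alpha> 1"
  shows "near_lift X Y p C 0 1 a b"
proof -
  have \<alpha>Y: "\<alpha> u \<in> topspace Y" if "u \<in> {0..1}" for u
    using path_image_subset_topspace[OF \<alpha>] that by blast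
  define P where "P s t \<longleftrightarrow> (0 \<le> s \<longrightarrow> s < t \<longrightarrow> t \<le> 1 \<longrightarrow>
      (\<forall>x\<in>topspace X. \<forall>y\<in>topspace X. p x = \<alpha> s \<longrightarrow> p y = \<alpha> t \<longrightarrow> near_lift X Y p C s t x y))" for s t
  have "P 0 1"
  proof (rule Bolzano)
    show "(0::real) \<le> 1" by simp
  next
    fix r s t assume rs: "P r s" and st: "P s t" and le: "r \<le> s" "s \<le> t"
    show "P r t"
    proof (cases "r = s \<or> s = t")
      case True
      with rs st show ?thesis by auto
    next
      case False
      show ?thesis
        unfolding P_def
      proof (intro impI ballI)
        fix x y assume *: "0 \<le> r" "t \<le> 1" "x \<in> topspace X" "y \<in> topspace X" "p x = \<alpha> r" "p y = \<alpha> t"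
        have "\<alpha> s \<in> p ` topspace X"
          using \<alpha>Y[of s] * le surj by simp
        then obtain z where z: "z \<in> topspace X" "p z = \<alpha> s" by force
        have lt: "r < s" "s < t" using le False by auto
        then have "near_lift X Y p C r s x z" "near_lift X Y p C s t z y"
          using rs st * z unfolding P_def by auto
        then show "near_lift X Y p C r t x y" using lt by (rule near_lift_trans)
      qed
    qed
  next
    fix x0 :: real assume "0 \<le> x0" "x0 \<le> 1"
    then have x0: "x0 \<in> {0..1}" by simp
    from bspec[OF C[unfolded tube_def] x0] obtain U d
      where U: "openin Y U" "\<alpha> x0 \<in> U" "d > 0"
        and UC: "\<forall>u\<in>{0..1}. \<bar>u - x0\<bar> < d \<longrightarrow> U \<subseteq> C u"
      by (elim exE conjE)
    have "\<alpha> x0 \<in> p ` topspace X" using \<alpha>Y[OF x0] surj by simp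
    then obtain z where z: "z \<in> topspace X" "p z = \<alpha> x0" by force
    obtain V where V: "openin Y V" "p z \<in> V"
      and link: "\<And>g y. \<lbrakk>pathin Y g; g \<in> {0..1} \<rightarrow> V; g 0 = p z; g 1 = p y; y \<in> topspace X\<rbrakk>
                  \<Longrightarrow> linked X Y p U z y"
      using sp[unfolded small_paths_linked_def, rule_format, OF z(1) U(1)] z(2) U(2) by metis
    have "openin (top_of_set {0..1}) {u \<in> topspace (top_of_set {0..1}). \<alpha> u \<in> V}"
      using \<alpha> V(1) unfolding pathin_def by (rule openin_continuous_map_preimage)
    moreover have "x0 \<in> {u \<in> topspace (top_of_set {0..1}). \<alpha> u \<in> V}" using x0 z V by simp
    ultimately obtain e where e: "e > 0" "\<And>u. u \<in> {0..1} \<Longrightarrow> dist u x0 < e \<Longrightarrow> \<alpha> u \<in> V"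
      unfolding openin_euclidean_subtopology_iff by (auto simp: Ball_def)
    \<comment> \<open>Apply \<open>link\<close> to \<open>\<alpha>\<close> run along the segment
      from \<open>x0\<close> to \<open>w\<close>, where \<open>w\<close> may lie on either side of
      \<open>x0\<close>.\<close>
    have zw: "linked X Y p U z y"
      if w: "w \<in> {0..1}" "\<bar>w - x0\<bar> < e" and y: "y \<in> topspace X" "p y = \<alpha> w" for w y
    proof -
      have seg: "x0 + (w - x0) * u \<in> {0..1}" "dist (x0 + (w - x0) * u) x0 < e" if u: "u \<in> {0..1}" for u
      proof -
        have "x0 + (w - x0) * u = (1 - u) * x0 + u * w" by (simp add: algebra_simps)
        then show "x0 + (w - x0) * u \<in> {0..1}"
          using u x0 w convex_bound_le[of x0 1 w "1 - u" u] by simp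
        have "\<bar>w - x0\<bar> * u \<le> \<bar>w - x0\<bar>" using u by (intro mult_left_le) auto
        then show "dist (x0 + (w - x0) * u) x0 < e"
          using u w(2) by (simp add: dist_real_def abs_mult)
      qed
      have "pathin Y (\<alpha> \<circ> (\<lambda>u. x0 + (w - x0) * u))"
        using \<alpha> unfolding pathin_def
        by (rule continuous_map_compose[rotated]) (use seg in \<open>auto intro!: continuous_intros\<close>)
      then show ?thesis
        by (rule link) (use e(2)[OF seg] z y in \<open>simp_all add: Pi_iff\<close>)
    qed
    have "P s t" if st: "s \<le> x0" "x0 \<le> t" "t - s < min d e" for s t
      unfolding P_def
    proof (intro impI ballI)
      fix x y assume *: "0 \<le> s" "s < t" "t \<le> 1" "x \<in> topspace X" "y \<in> topspace X" "p x = \<alpha> s" "p y = \<alpha> t"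
      have "linked X Y p U z x" by (rule zw[of s]) (use * st in auto)
      moreover have "linked X Y p U z y" by (rule zw[of t]) (use * st in auto)
      \<comment> \<open>The linking passes through \<open>z\<close>, because \<open>V\<close>
        controls only paths that start at \<open>p z\<close>.\<close>
      ultimately have "near_lift X Y p (\<lambda>_. U) 0 1 x y"
        unfolding linked_def[symmetric] by (rule linked_trans[OF linked_sym])
      then have "near_lift X Y p (\<lambda>_. U) s t x y"
        by (rule near_lift_rescale) (use * in auto)
      \<comment> \<open>The interval contains \<open>x0\<close> and is shorter than
        \<open>d\<close>, so \<open>U\<close> obeys the constraint throughout it.\<close>
      then show "near_lift X Y p C s t x y"
        by (rule near_lift_mono, intro UC[rule_format]) (use * st in auto)
    qed
    then show "\<exists>d>0. \<forall>s t. s \<le> x0 \<and> x0 \<le> t \<and> t - s < d \<longrightarrow> P s t"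
      using U(3) e(1) by (intro exI[of _ "min d e"] conjI allI impI) simp_all
  qed
  with ends show ?thesis unfolding P_def by simp
qed

text \<open>The preimage of \<open>W\<close> in the loop space is open, so it contains all loops in
  some tube around a loop \<open>\<alpha>\<close>. One of these is homotopic to the projection of a
  loop in \<open>X\<close>, and the class of that projection lies in \<open>W\<close>.\<close>

lemma pi1_induced_dense:
  assumes p: "continuous_map X Y p" and surj: "p ` topspace X = topspace Y"
    and sp: "small_paths_linked X Y p" and a: "a \<in> topspace X"
    and W: "openin (pi1_top Y (p a)) W" "W \<noteq> {}"
  shows "pi1_induced Y a p ` topspace (pi1_top X a) \<inter> W \<noteq> {}"
proof -
  let ?I = "top_of_set {0..1::real}"
  have "W \<subseteq> loop_class Y (p a) ` loops Y (p a)"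
    using openin_subset[OF W(1)] by (simp add: topspace_pi1_top)
  then obtain \<alpha> where \<alpha>: "\<alpha> \<in> loops Y (p a)" "loop_class Y (p a) \<alpha> \<in> W" using W(2) by blast
  let ?W = "{g \<in> loops Y (p a). loop_class Y (p a) g \<in> W}"
  have openW: "openin (loop_space Y (p a)) ?W"
    using W(1) by (simp add: pi1_top_def openin_quotient_topology topspace_loop_space)
  have "\<alpha> \<in> ?W" using \<alpha> by simp
  from loop_space_neighbourhood[OF openW this] obtain C where
    C: "tube Y \<alpha> C"
    and CW: "\<forall>g\<in>loops Y (p a). (\<forall>u\<in>{0..1}. g u \<in> C u) \<longrightarrow> g \<in> ?W"
    by (elim exE conjE)
  have "near_lift X Y p C 0 1 a a"
    using \<alpha>(1) a by (intro near_lift_loop[OF sp surj _ C]) (auto simp: loops_def)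
  then obtain H \<beta> where H: "continuous_map (prod_topology ?I ?I) Y H"
    and \<beta>: "continuous_map ?I X \<beta>" "\<beta> 0 = a" "\<beta> 1 = a"
    and H1: "\<And>u. u\<in>{0..1} \<Longrightarrow> H (0, u) \<in> C u \<and> H (1, u) = p (\<beta> u)"
    and H2: "\<And>r. r\<in>{0..1::real} \<Longrightarrow> H (r, 0) = p a \<and> H (r, 1) = p a"
    unfolding near_lift_def by blast
  \<comment> \<open>The initial path of \<open>H\<close> runs in the tube, so its class is in
    \<open>W\<close>; no homotopy between it and \<open>\<alpha>\<close> is involved.\<close>
  define \<gamma> where "\<gamma> = restrict (\<lambda>u. H (0, u)) {0..1}"
  define \<beta>' where "\<beta>' = restrict \<beta> {0..1}"
  have \<beta>': "\<beta>' \<in> loops X a" unfolding \<beta>'_def using \<beta> by (rule loops_restrict)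
  have "continuous_map ?I Y (H \<circ> Pair 0)"
    using H by (rule continuous_map_o_Pair) simp
  then have "\<gamma> \<in> loops Y (p a)"
    unfolding \<gamma>_def using H2[of 0] by (intro loops_restrict) (auto simp: o_def)
  then have "\<gamma> \<in> ?W" by (rule CW[rule_format]) (use H1 in \<open>auto simp: \<gamma>_def\<close>)
  moreover have hom: "loop_homotopic Y (p a) \<gamma> (restrict (p \<circ> \<beta>') {0..1})"
    unfolding loop_homotopic_def
  proof (subst homotopic_with)
    show "\<exists>h. continuous_map (prod_topology ?I ?I) Y h \<and> (\<forall>x\<in>topspace ?I. h (0, x) = \<gamma> x) \<and>
        (\<forall>x\<in>topspace ?I. h (1, x) = restrict (p \<circ> \<beta>') {0..1} x) \<and>
        (\<forall>t\<in>{0..1}. h (t, 0) = p a \<and> h (t, 1) = p a)"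
      using H H1 H2 by (intro exI[of _ H]) (auto simp: \<gamma>_def \<beta>'_def)
  qed auto
  ultimately have "pi1_induced Y a p (loop_class X a \<beta>') \<in> W"
    using loop_class_eqI[OF hom] by (simp add: pi1_induced_loop_class[OF p \<beta>'])
  then show ?thesis using \<beta>' by (auto simp: topspace_pi1_top)
qed

section \<open>Surjectivity and closedness from density, compactness and separation\<close>

theorem theorem4p4:
  fixes X :: "'a topology" and n :: nat and A :: "nat \<Rightarrow> 'a set" and a :: 'a
  assumes "condition_star X n A"
    and "a \<in> (\<Union>i\<in>{1..n}. A i)"
    and "compact_space (pi1_top X a)"
    and "Hausdorff_space (pi1_top (collapse_space X n A) (collapse_map X n A a))"
  shows "pi1_induced (collapse_space X n A) a (collapse_map X n A) ` topspace (pi1_top X a)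
           = topspace (pi1_top (collapse_space X n A) (collapse_map X n A a))
       \<and> closed_map (pi1_top X a) (pi1_top (collapse_space X n A) (collapse_map X n A a))
           (pi1_induced (collapse_space X n A) a (collapse_map X n A))
       \<and> quotient_map (pi1_top X a) (pi1_top (collapse_space X n A) (collapse_map X n A a))
           (pi1_induced (collapse_space X n A) a (collapse_map X n A))"
proof -
  let ?p = "collapse_map X n A" and ?Y = "collapse_space X n A"
  let ?f = "pi1_induced ?Y a ?p" and ?G = "pi1_top ?Y (?p a)"
  note q = quotient_map_collapse[of X n A]
  note p = quotient_imp_continuous_map[OF q] and surj = quotient_imp_surjective_map[OF q]
  have pc: "path_connectedin X (X closure_of A i)"
    and oc: "openin X (A i) \<or> closedin X (A i)" if "i \<in> {1..n}" for i
    using assms(1) that unfolding condition_star_def by blast+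
  have a: "a \<in> topspace X"
    using assms(2) oc openin_subset closedin_subset by blast
  have "small_paths_linked X ?Y ?p"
  \<comment> \<open>If some \<open>A i\<close> is not open, only the second alternative of
    \<open>condition_star\<close> remains, and it provides local path connectedness.\<close>
  proof (cases "\<forall>i\<in>{1..n}. openin X (A i)")
    case True
    then show ?thesis using pc by (intro small_paths_linked_open) auto
  next
    case False
    then have "locally_path_connected_space X"
      using assms(1) unfolding condition_star_def by blast
    then show ?thesis
      using pc by (intro small_paths_linked_locally_path_connected[OF q] linked_collapse_fibre)
  qed
  then have "?G closure_of (?f ` topspace (pi1_top X a)) = topspace ?G"
    unfolding dense_intersects_open using pi1_induced_dense[OF p surj _ a] by blast
  moreover have cont: "continuous_map (pi1_top X a) ?G ?f"
    by (rule continuous_map_pi1_induced[OF p])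
  then have closed: "closed_map (pi1_top X a) ?G ?f"
    using assms(3,4) by (rule continuous_imp_closed_map)
  then have "closedin ?G (?f ` topspace (pi1_top X a))"
    unfolding closed_map_def by blast
  ultimately have onto: "?f ` topspace (pi1_top X a) = topspace ?G"
    by (simp add: closure_of_closedin)
  moreover have "quotient_map (pi1_top X a) ?G ?f"
    using cont assms(3,4) onto by (rule continuous_imp_quotient_map)
  ultimately show ?thesis using closed by blast
qed

end
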